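(* Let $N \geq 4$. The following is a complete ordering of the set $\mathcal{T}_{N,3}$ of all trees (up to isomorphism) with $N$ nodes and diameter $3$: every tree in $\mathcal{T}_{N,3}$ is one of the double palm trees $D_{N,p,N-2-p}$ with $1 \leq p \leq \lfloor\frac{N-2}{2}\rfloor$, each of these trees lies in $\mathcal{T}_{N,3}$, and $$\mathcal{H}_2\left(D_{N,1,N-3}\right) < \mathcal{H}_2\left(D_{N,2,N-4}\right) < \cdots < \mathcal{H}_2\left(D_{N,\lfloor\frac{N-2}{2}\rfloor,\lceil\frac{N-2}{2}\rceil}\right).$$
   Context: All trees are finite, undirected, with unit weight on every edge; equality of trees means graph isomorphism. The distance between two nodes is the number of edges on the path joining them, and the diameter of a tree is the maximum distance between two of its nodes. $\mathcal{T}_{N,d}$ is the set of all trees with $N$ nodes and diameter $d$. $\mathcal{H}_2$ norm: for a connected undirected graph on $N$ nodes with Laplacian $L = D - A$ ($A$ the adjacency matrix, $D$ the diagonal matrix of degrees), let $0=\lambda_1 < \lambda_2 \leq \dots \leq \lambda_N$ be the eigenvalues of $L$. The $\mathcal{H}_2$ norm of the graph is $\mathcal{H}_2 = \left(\sum_{i=2}^{N}\frac{1}{2\lambda_i}\right)^{1/2}$. (This is the $\mathcal{H}_2$ norm of the system $\dot y = -QLQ^T y + Q\xi$ with output $z=y$, where the rows of $Q\in\mathbb{R}^{(N-1)\times N}$ form an orthonormal basis of the orthogonal complement of the all-ones vector.) Double palm tree: for positive integers $p,q$ with $p+q \leq N-2$, $D_{N,p,q}$ is the tree on $N$ nodes obtained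 from a path with $N-p-q \geq 2$ nodes by attaching $p$ leaf nodes to one end node of this path and $q$ leaf nodes to its other end node. Note $D_{N,p,q}=D_{N,q,p}$. *)

theory Defs
  imports
    "Graph_Theory.Graph_Theory"
    "Jordan_Normal_Form.Char_Poly"
    Complex_Main
begin

text \<open>Finite simple undirected graphs are the symmetric loop-free digraphs \<^locale>\<open>pair_graph\<close>:
  an undirected edge is a pair of opposite arcs.\<close>

text \<open>The library's notions of forest and tree are meant for oriented graphs: in a symmetric digraph
  each edge, traversed back and forth, is a directed cycle of length 2. These are the only
  directed cycles that are not cycles of the undirected graph.\<close>

definition undirected_tree :: "'a pair_pre_digraph \<Rightarrow> bool" where
  "undirected_tree G \<longleftrightarrow> pair_graph G \<and> connected (with_proj G) \<and>
     \<not> (\<exists>c. pre_digraph.cycle (with_proj G) c \<and> length c \<ge> 3)"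

definition distance :: "'a pair_pre_digraph \<Rightarrow> 'a \<Rightarrow> 'a \<Rightarrow> ereal" where
  "distance G u v = wf_digraph.\<mu> (with_proj G) (\<lambda>_. 1) u v"

definition graph_diameter :: "'a pair_pre_digraph \<Rightarrow> ereal" where
  "graph_diameter G = (SUP u\<in>pverts G. SUP v\<in>pverts G. distance G u v)"

definition trees :: "nat \<Rightarrow> nat \<Rightarrow> 'a pair_pre_digraph set" where
  "trees N d = {G. undirected_tree G \<and> card (pverts G) = N \<and> graph_diameter G = ereal (real d)}"

text \<open>Rows and columns of the matrices follow the increasing order of the nodes; the spectrum does
  not depend on this order.\<close>

definition adjacency_mat :: "'a :: linorder pair_pre_digraph \<Rightarrow> real mat" where
  "adjacency_mat G = (let vs = sorted_list_of_set (pverts G) in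
     mat (length vs) (length vs) (\<lambda>(i, j). if (vs ! i, vs ! j) \<in> parcs G then 1 else 0))"

definition degree_mat :: "'a :: linorder pair_pre_digraph \<Rightarrow> real mat" where
  "degree_mat G = (let vs = sorted_list_of_set (pverts G) in
     mat_diag (length vs) (\<lambda>i. real (out_degree (with_proj G) (vs ! i))))"

definition laplacian_mat :: "'a :: linorder pair_pre_digraph \<Rightarrow> real mat" where
  "laplacian_mat G = degree_mat G - adjacency_mat G"

text \<open>All eigenvalues of the symmetric Laplacian are real, so with multiplicity there are as many
  roots of the real characteristic polynomial as nodes. The list is increasing and indexed
  from 0, so that \<open>laplacian_spectrum G ! (i - 1)\<close> is \<open>\<lambda>\<^sub>i\<close>.\<close>

definition laplacian_spectrum :: "'a :: linorder pair_pre_digraph \<Rightarrow> real list" where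
  "laplacian_spectrum G = sorted_list_of_multiset (proots (char_poly (laplacian_mat G)))"

definition H2_norm :: "'a :: linorder pair_pre_digraph \<Rightarrow> real" where
  "H2_norm G = sqrt (\<Sum>i = 2..card (pverts G). 1 / (2 * laplacian_spectrum G ! (i - 1)))"

text \<open>With \<open>m = N - p - q\<close>, the path is \<open>0, \<dots>, m - 1\<close>; the nodes \<open>m, \<dots>, m + p - 1\<close> are
  leaves at \<open>0\<close> and the nodes \<open>m + p, \<dots>, N - 1\<close> are leaves at \<open>m - 1\<close>.\<close>

definition double_palm :: "nat \<Rightarrow> nat \<Rightarrow> nat \<Rightarrow> nat pair_pre_digraph" where
  "double_palm N p q = (let m = N - p - q;
     E = {(i, Suc i) | i. Suc i < m} \<union> {0} \<times> {m..<m + p} \<union> {m - 1} \<times> {m + p..<N}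
     in \<lparr>pverts = {..<N}, parcs = E \<union> E\<inverse>\<rparr>)"

end

theory Submission
  imports Defs
begin

text \<open>A tree of diameter 3 is a double star: the middle edge \<open>b c\<close> of a path of length 3 is a bridge,
  so any walk from the side of \<open>b\<close> to the far end of that path has to go through \<open>b\<close> and \<open>c\<close>, and a
  walk of length at most 3 has room for at most one step before \<open>b\<close>. Hence every node
  on the side of \<open>b\<close> is \<open>b\<close> or a neighbour of \<open>b\<close> (\<open>near_bridge_end\<close>), likewise for \<open>c\<close>, and
  since there are no triangles the neighbours are leaves
  (\<open>tree_diameter_3_imp_double_star\<close>). A double star is determined up to isomorphism by its two
  numbers of leaves (\<open>double_star_iso\<close>), which yields the classification.

  For the ordering, let \<open>p\<close> and \<open>q\<close> be the numbers of leaves, \<open>N = p + q + 2\<close>. The leaf block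
  of \<open>x I - L\<close> is \<open>(x - 1) I\<close>, so eliminating it leaves a determinant of size 2
  (\<open>char_poly_double_palm\<close>), and the characteristic polynomial of the Laplacian is
  \<open>x (x - 1)^(N - 4) f(x)\<close> with \<open>f(x) = x^3 - (N + 2) x^2 + (p q + 2 N + 1) x - N\<close>. The
  cubic has three positive roots (\<open>cubic_three_positive_roots\<close>). The norm only involves the sum of
  the reciprocals of the positive eigenvalues, and for the roots of \<open>f\<close> that sum is
  \<open>(p q + 2 N + 1) / N\<close> by Vieta, whatever the roots are (\<open>H2_norm_double_palm\<close>). For fixed \<open>N\<close> the
  norm is thus an increasing function of the product \<open>p q\<close>, which grows as \<open>p\<close> and \<open>q\<close> get closer
  to each other.\<close>

section \<open>Distance and diameter in terms of powers of the arc relation\<close>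

lemma (in pair_wf_digraph) awalk_of_length_iff_relpow:
  "u \<in> pverts G \<Longrightarrow> (\<exists>p. awalk u p v \<and> length p = n) \<longleftrightarrow> (u, v) \<in> parcs G ^^ n"
proof (induction n arbitrary: u)
  case 0
  then show ?case by (auto simp: awalk_Nil_iff)
next
  case (Suc n)
  have "(\<exists>p. awalk u p v \<and> length p = Suc n)
      \<longleftrightarrow> (\<exists>w. (u, w) \<in> parcs G \<and> (\<exists>p. awalk w p v \<and> length p = n))"
  proof
    assume "\<exists>p. awalk u p v \<and> length p = Suc n"
    then obtain e p where "awalk u (e # p) v" "length p = n" by (auto simp: length_Suc_conv)
    then have "(u, snd e) \<in> parcs G" "awalk (snd e) p v" "length p = n"
      by (auto simp: awalk_Cons_iff)
    then show "\<exists>w. (u, w) \<in> parcs G \<and> (\<exists>p. awalk w p v \<and> length p = n)" by blast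
  next
    assume "\<exists>w. (u, w) \<in> parcs G \<and> (\<exists>p. awalk w p v \<and> length p = n)"
    then obtain w p where "(u, w) \<in> parcs G" "awalk w p v" "length p = n" by blast
    then have "awalk u ((u, w) # p) v" "length ((u, w) # p) = Suc n"
      by (simp_all add: awalk_Cons_iff)
    then show "\<exists>p. awalk u p v \<and> length p = Suc n" by blast
  qed
  also have "\<dots> \<longleftrightarrow> (\<exists>w. (u, w) \<in> parcs G \<and> (w, v) \<in> parcs G ^^ n)"
    using Suc.IH in_arcsD2 by blast
  also have "\<dots> \<longleftrightarrow> (u, v) \<in> parcs G ^^ Suc n"
    by (meson relpow_Suc_D2 relpow_Suc_I2)
  finally show ?case .
qed

lemma distance_le_iff:
  assumes "pair_wf_digraph G" and u: "u \<in> pverts G"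
  shows "distance G u v \<le> ereal (real n) \<longleftrightarrow> (\<exists>k\<le>n. (u, v) \<in> parcs G ^^ k)"
    and "distance G u v < ereal (real (Suc n)) \<longleftrightarrow> (\<exists>k\<le>n. (u, v) \<in> parcs G ^^ k)"
proof -
  interpret pair_wf_digraph G by fact
  have cost: "awalk_cost (\<lambda>_. 1) p = real (length p)" for p
    by (induction p) auto
  have walk: "\<exists>k\<le>n. (u, v) \<in> parcs G ^^ k" if "distance G u v < ereal (real (Suc n))"
  proof -
    from that obtain p where p: "awalk u p v" and "ereal (real (length p)) < ereal (real (Suc n))"
      unfolding distance_def \<mu>_def INF_less_iff cost by blast
    then have "length p \<le> n" by simp
    moreover have "(u, v) \<in> parcs G ^^ length p"
      using awalk_of_length_iff_relpow[OF u, of v "length p"] p by blast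
    ultimately show ?thesis by blast
  qed
  have le: "distance G u v \<le> ereal (real n)" if "\<exists>k\<le>n. (u, v) \<in> parcs G ^^ k"
  proof -
    from that obtain k where "k \<le> n" "(u, v) \<in> parcs G ^^ k" by blast
    then obtain p where p: "awalk u p v" "length p \<le> n"
      using awalk_of_length_iff_relpow[OF u, of v k] by blast
    have "distance G u v \<le> ereal (real (length p))"
      using min_cost_le_walk_cost[OF p(1), of "\<lambda>_. 1"] unfolding distance_def cost .
    also have "\<dots> \<le> ereal (real n)" using p by simp
    finally show ?thesis .
  qed
  have less: "ereal (real n) < ereal (real (Suc n))" by simp
  show "distance G u v < ereal (real (Suc n)) \<longleftrightarrow> (\<exists>k\<le>n. (u, v) \<in> parcs G ^^ k)"
    using walk le less by (meson le_less_trans)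
  show "distance G u v \<le> ereal (real n) \<longleftrightarrow> (\<exists>k\<le>n. (u, v) \<in> parcs G ^^ k)"
    using walk le less by (meson le_less_trans)
qed

text \<open>The diameter is a supremum of extended reals; as distances are natural numbers or infinite, it
  takes the value \<open>n + 1\<close> exactly if every pair of nodes has a walk of length at most \<open>n + 1\<close>
  and some pair has none of length at most \<open>n\<close>.\<close>

lemma graph_diameter_eq_Suc_iff:
  assumes G: "pair_wf_digraph G"
  shows "graph_diameter G = ereal (real (Suc n)) \<longleftrightarrow>
    (\<forall>u\<in>pverts G. \<forall>v\<in>pverts G. \<exists>k\<le>Suc n. (u, v) \<in> parcs G ^^ k) \<and>
    (\<exists>u\<in>pverts G. \<exists>v\<in>pverts G. \<forall>k\<le>n. (u, v) \<notin> parcs G ^^ k)"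
    (is "?diam \<longleftrightarrow> ?le \<and> ?ge")
proof -
  have upper: "graph_diameter G \<le> ereal (real m)
      \<longleftrightarrow> (\<forall>u\<in>pverts G. \<forall>v\<in>pverts G. \<exists>k\<le>m. (u, v) \<in> parcs G ^^ k)" for m
    unfolding graph_diameter_def SUP_le_iff using distance_le_iff(1)[OF G] by blast
  have lower: "ereal (real (Suc n)) \<le> graph_diameter G" if ?ge
  proof -
    from that obtain u v where uv: "u \<in> pverts G" "v \<in> pverts G"
      and "\<not> distance G u v < ereal (real (Suc n))"
      using distance_le_iff(2)[OF G] by blast
    then have "ereal (real (Suc n)) \<le> distance G u v" by simp
    also have "\<dots> \<le> graph_diameter G"
      unfolding graph_diameter_def by (rule SUP_upper2[OF uv(1) SUP_upper[OF uv(2)]])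
    finally show ?thesis .
  qed
  show ?thesis
  proof
    assume diam: ?diam
    then have "\<not> graph_diameter G \<le> ereal (real n)" by simp
    then have ?ge unfolding upper by blast
    moreover have ?le using diam unfolding upper[symmetric] by simp
    ultimately show "?le \<and> ?ge" by blast
  next
    assume "?le \<and> ?ge"
    then have "graph_diameter G \<le> ereal (real (Suc n))" "ereal (real (Suc n)) \<le> graph_diameter G"
      using lower unfolding upper by blast+
    then show ?diam by (rule antisym)
  qed
qed

section \<open>Trees of diameter 3 are double stars\<close>

text \<open>A walk from \<open>b\<close> to \<open>c\<close> that avoids the edge contains a path of length at least 2, which the
  edge closes to a cycle of length at least 3.\<close>

lemma undirected_tree_edge_bridge:
  assumes tree: "undirected_tree G" and bc: "(b, c) \<in> parcs G"
  shows "(b, c) \<notin> (parcs G - {(b, c), (c, b)})\<^sup>*"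
proof
  assume reach: "(b, c) \<in> (parcs G - {(b, c), (c, b)})\<^sup>*"
  interpret pair_graph G using tree by (simp add: undirected_tree_def)
  define H where "H = \<lparr>pverts = pverts G, parcs = parcs G - {(b, c), (c, b)}\<rparr>"
  have H: "pverts H = pverts G" "parcs H = parcs G - {(b, c), (c, b)}"
    by (simp_all add: H_def)
  interpret H: pair_wf_digraph H
    by unfold_locales (auto simp: H intro: wellformed')
  have "b \<in> pverts H" using bc by (simp add: H in_arcsD1)
  then have "b \<rightarrow>\<^sup>*\<^bsub>H\<^esub> c"
    using reach by (subst H.reachable_conv') (auto simp: H)
  then obtain p where p: "H.apath b p c" by (auto simp: H.reachable_apath)
  have "b \<noteq> c" using bc no_loops' by blast
  then have "length p \<ge> 2"
    using p by (cases p; cases "tl p") (auto simp: H.apath_def H.awalk_simps H(2))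
  moreover have "cycle ((c, b) # p)"
    using p bc arcs_symmetric[OF bc]
    by (auto simp: cycle_def H.apath_def H.awalk_def awalk_Cons_iff awalk_def H intro: wellformed')
  ultimately show False
    using tree unfolding undirected_tree_def by force
qed

text \<open>Here \<open>b\<close> and \<open>c\<close> are the two adjacent centres, and \<open>P\<close> and \<open>Q\<close> are their sets of
  leaves.\<close>

definition double_star :: "'a pair_pre_digraph \<Rightarrow> 'a \<Rightarrow> 'a \<Rightarrow> 'a set \<Rightarrow> 'a set \<Rightarrow> bool" where
  "double_star G b c P Q \<longleftrightarrow>
     finite P \<and> finite Q \<and> distinct [b, c] \<and> {b, c} \<inter> (P \<union> Q) = {} \<and> P \<inter> Q = {} \<and>
     pverts G = {b, c} \<union> P \<union> Q \<and>
     parcs G = (let E = {(b, c)} \<union> {b} \<times> P \<union> {c} \<times> Q in E \<union> E\<inverse>)"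

lemma double_star_swap: "double_star G b c P Q \<Longrightarrow> double_star G c b Q P"
  unfolding double_star_def Let_def by auto

lemma card_double_star: "double_star G b c P Q \<Longrightarrow> card (pverts G) = card P + card Q + 2"
  by (auto simp: double_star_def card_Un_disjoint)

lemma double_star_double_palm:
  assumes "N = p + q + 2"
  shows "double_star (double_palm N p q) 0 1 {2..<p + 2} {p + 2..<N}"
  using assms by (auto simp: double_star_def double_palm_def Let_def less_Suc_eq)

lemma double_star_iso:
  assumes G: "double_star G b c P Q" and H: "double_star H b' c' P' Q'"
    and P: "card P = card P'" and Q: "card Q = card Q'"
  shows "digraph_iso (with_proj G) (with_proj H)"
proof -
  have fin: "finite P" "finite P'" "finite Q" "finite Q'"
    using G H by (auto simp: double_star_def)
  obtain g where g: "bij_betw g P P'" using finite_same_card_bij P fin by blast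
  obtain h where h: "bij_betw h Q Q'" using finite_same_card_bij Q fin by blast
  define f where "f x = (if x = b then b' else if x = c then c' else if x \<in> P then g x else h x)" for x
  define i where "i = \<lparr>iso_verts = f, iso_arcs = map_prod f f, iso_head = snd, iso_tail = fst\<rparr>"
  have f: "f b = b'" "f c = c'" "f ` P = P'" "f ` Q = Q'"
  proof -
    have "f ` P = g ` P" "f ` Q = h ` Q"
      using G by (auto simp: f_def double_star_def intro!: image_cong)
    then show "f ` P = P'" "f ` Q = Q'" using g h by (auto simp: bij_betw_def)
  qed (use G in \<open>auto simp: f_def double_star_def\<close>)
  have verts: "pverts H = f ` pverts G"
    using G H by (auto simp: double_star_def image_Un f)
  \<comment> \<open>Both graphs have the same number of nodes, so surjectivity gives injectivity.\<close>
  have "card (f ` pverts G) = card (pverts G)"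
    unfolding verts[symmetric] card_double_star[OF G] card_double_star[OF H] P Q ..
  moreover have "finite (pverts G)" using G by (auto simp: double_star_def)
  ultimately have inj: "inj_on f (pverts G)" by (rule eq_card_imp_inj_on[rotated])
  have arcs: "parcs H = map_prod f f ` parcs G"
  proof -
    have converse: "map_prod f f ` S\<inverse> = (map_prod f f ` S)\<inverse>" for S by force
    have "map_prod f f ` ({b} \<times> P) = {b'} \<times> P'" "map_prod f f ` ({c} \<times> Q) = {c'} \<times> Q'"
      using f by (simp_all add: map_prod_surj_on)
    then show ?thesis
      using G H f unfolding double_star_def Let_def
      by (simp only: image_Un converse image_insert image_empty map_prod_simp)
  qed
  have "pair_wf_digraph G"
    using G by unfold_locales (auto simp: double_star_def Let_def)
  then interpret pair_wf_digraph G .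
  have "inj_on (map_prod f f) (parcs G)"
    by (rule inj_on_subset[OF map_prod_inj_on[OF inj inj]]) (auto intro: wellformed')
  then have "digraph_isomorphism i"
    using inj wf_digraph_axioms by (auto simp: digraph_isomorphism_def i_def)
  moreover have "with_proj H = app_iso i (with_proj G)"
    by (simp add: app_iso_def i_def with_proj_def verts arcs)
  ultimately show ?thesis unfolding digraph_iso_def by blast
qed

text \<open>The set \<open>B\<close> of nodes on the side of \<open>b\<close> can only be left by the arc from \<open>b\<close> to \<open>c\<close>. On a
  walk from \<open>x \<in> B\<close> to \<open>d \<notin> B\<close> this arc cannot be the last one, because \<open>d \<noteq> c\<close>; if the walk has
  at most 3 arcs, it is therefore the first or the second one.\<close>

lemma near_bridge_end:
  assumes tree: "undirected_tree G" and bc: "(b, c) \<in> parcs G" and cd: "(c, d) \<in> parcs G" "d \<noteq> b"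
    and x: "(b, x) \<in> (parcs G - {(b, c), (c, b)})\<^sup>*" and xd: "\<exists>k\<le>3. (x, d) \<in> parcs G ^^ k"
  shows "x = b \<or> (b, x) \<in> parcs G"
proof -
  interpret pair_graph G using tree by (simp add: undirected_tree_def)
  define R where "R = parcs G - {(b, c), (c, b)}"
  define B where "B = {y. (b, y) \<in> R\<^sup>*}"
  have bridge: "c \<notin> B"
    using undirected_tree_edge_bridge[OF tree bc] by (simp add: B_def R_def)
  have step: "w \<in> B" if "(v, w) \<in> R" "v \<in> B" for v w
    using that by (auto simp: B_def)
  have step': "v \<in> B" if "(v, w) \<in> R" "w \<in> B" for v w
    using that arcs_symmetric step unfolding R_def by blast
  have crossing: "v = b \<and> w = c" if "(v, w) \<in> parcs G" "v \<in> B" "w \<notin> B" for v w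
    using that step bridge unfolding R_def by blast
  have "b \<in> B" by (simp add: B_def)
  have d: "d \<notin> B" "d \<noteq> c"
    using cd bridge step'[of c d] no_loops' by (auto simp: R_def)
  have "x \<in> B" using x by (simp add: B_def R_def)
  from xd consider "x = d" | "(x, d) \<in> parcs G"
    | w where "(x, w) \<in> parcs G" "(w, d) \<in> parcs G"
    | w w' where "(x, w) \<in> parcs G" "(w, w') \<in> parcs G" "(w', d) \<in> parcs G"
    by (auto simp: le_Suc_eq numeral_3_eq_3)
  then show ?thesis
  proof cases
    case 1 then show ?thesis using d \<open>x \<in> B\<close> by blast
  next
    case 2 then show ?thesis using crossing d \<open>x \<in> B\<close> by blast
  next
    case 3 then show ?thesis using crossing d \<open>x \<in> B\<close> by blast
  next
    case 4 then show ?thesis using crossing d \<open>x \<in> B\<close> arcs_symmetric by blast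
  qed
qed

lemma tree_diameter_3_imp_double_star:
  assumes tree: "undirected_tree G" and diam: "graph_diameter G = ereal 3"
  obtains b c P Q where "double_star G b c P Q" "P \<noteq> {}" "Q \<noteq> {}"
proof -
  interpret pair_graph G using tree by (simp add: undirected_tree_def)
  let ?E = "parcs G"
  have le3: "\<exists>k\<le>3. (u, v) \<in> ?E ^^ k" if "u \<in> pverts G" "v \<in> pverts G" for u v
    using that diam graph_diameter_eq_Suc_iff[of G 2] pair_wf_digraph by auto
  obtain a d where ad: "a \<in> pverts G" "d \<in> pverts G" and far: "\<And>k. k \<le> 2 \<Longrightarrow> (a, d) \<notin> ?E ^^ k"
    using diam graph_diameter_eq_Suc_iff[of G 2] pair_wf_digraph by auto
  have "(a, d) \<in> ?E ^^ 3"
    using le3[OF ad] far by (auto simp: le_Suc_eq numeral_3_eq_3 numeral_2_eq_2)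
  then obtain b c where ab: "(a, b) \<in> ?E" and bc: "(b, c) \<in> ?E" and cd: "(c, d) \<in> ?E"
    by (auto simp: numeral_3_eq_3)
  have "a \<noteq> c" "d \<noteq> b" using far[of 1] ab cd by auto
  note sym = arcs_symmetric
  define R where "R = ?E - {(b, c), (c, b)}"
  have R': "R = ?E - {(c, b), (b, c)}" by (auto simp: R_def)
  define B where "B = {x. (b, x) \<in> R\<^sup>*}"
  define C where "C = {x. (c, x) \<in> R\<^sup>*}"
  have "sym R" using sym by (auto simp: R_def intro: symI)
  then have disj: "B \<inter> C = {}"
    using undirected_tree_edge_bridge[OF tree bc]
    by (auto simp: B_def C_def simp flip: R_def) (meson rtrancl_trans sym_rtrancl symD)
  have B: "x = b \<or> (b, x) \<in> ?E" if "x \<in> B" "x \<in> pverts G" for x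
    using near_bridge_end[OF tree bc cd \<open>d \<noteq> b\<close>, of x] that le3[of x d] ad by (auto simp: B_def R_def)
  have C: "x = c \<or> (c, x) \<in> ?E" if "x \<in> C" "x \<in> pverts G" for x
    using near_bridge_end[OF tree sym[OF bc] sym[OF ab] \<open>a \<noteq> c\<close>, of x] that le3[of x a] ad
    by (auto simp: C_def R')
  have b: "b \<in> B" and c: "c \<in> C" by (auto simp: B_def C_def)
  have arc: "(x, y) \<in> {(b, c), (c, b)} \<or> {x, y} \<subseteq> B \<or> {x, y} \<subseteq> C"
    if "(x, y) \<in> ?E" "x \<in> B \<union> C" for x y
    using that by (auto simp: B_def C_def R_def intro: rtrancl_into_rtrancl)
  have cover: "x \<in> B \<union> C" if "x \<in> pverts G" for x
  proof -
    have "(b, x) \<in> ?E\<^sup>*"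
      using le3[of b x] that bc in_arcsD1 by (meson relpow_imp_rtrancl)
    then show ?thesis
      by induction (use arc b c in blast)+
  qed
  \<comment> \<open>In a triangle, each edge can be bypassed through the third node.\<close>
  have no_triangle: False if "(v, x) \<in> ?E" "(v, y) \<in> ?E" "(x, y) \<in> ?E" for v x y
  proof -
    have "v \<noteq> x" "v \<noteq> y" using that no_loops' by blast+
    then have "(x, v) \<in> ?E - {(x, y), (y, x)}" "(v, y) \<in> ?E - {(x, y), (y, x)}"
      using that sym by auto
    then show False
      using undirected_tree_edge_bridge[OF tree that(3)] by (meson r_into_rtrancl rtrancl_trans)
  qed
  define P where "P = {x. (b, x) \<in> ?E \<and> x \<noteq> c}"
  define Q where "Q = {x. (c, x) \<in> ?E \<and> x \<noteq> b}"
  have PB: "P \<subseteq> B" and QC: "Q \<subseteq> C"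
    using no_loops' by (auto simp: P_def Q_def B_def C_def R_def intro!: r_into_rtrancl)
  have verts: "pverts G = {b, c} \<union> P \<union> Q"
    using cover B C disj b c bc wellformed' unfolding P_def Q_def by blast
  define E where "E = {(b, c)} \<union> {b} \<times> P \<union> {c} \<times> Q"
  have "(x, y) \<in> E \<union> E\<inverse>"
    if xy: "(x, y) \<in> ?E" for x y
  proof -
    have V: "x \<in> pverts G" "y \<in> pverts G" using xy wellformed' by blast+
    consider "(x, y) \<in> {(b, c), (c, b)}" | "{x, y} \<subseteq> B" | "{x, y} \<subseteq> C"
      using arc[OF xy] cover[OF V(1)] by blast
    then show ?thesis
    proof cases
      case 2
      then have "x = b \<or> y = b" using B V xy no_triangle by blast
      then show ?thesis using 2 xy sym disj c unfolding E_def P_def by blast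
    next
      case 3
      then have "x = c \<or> y = c" using C V xy no_triangle by blast
      then show ?thesis using 3 xy sym disj b unfolding E_def Q_def by blast
    qed (auto simp: E_def)
  qed
  then have "?E \<subseteq> E \<union> E\<inverse>" by (rule subrelI)
  moreover have "E \<subseteq> ?E" using bc by (auto simp: E_def P_def Q_def)
  moreover have "E\<inverse> \<subseteq> ?E" using calculation(2) sym by blast
  ultimately have "?E = E \<union> E\<inverse>" by blast
  then have arcs: "?E = (let E = {(b, c)} \<union> {b} \<times> P \<union> {c} \<times> Q in E \<union> E\<inverse>)"
    by (simp only: Let_def E_def)
  have "finite (P \<union> Q)" using pair_finite_verts verts by (metis finite_Un)
  then have fin: "finite P" "finite Q" by simp_all
  have "b \<noteq> c" "b \<notin> P" "c \<notin> Q" using bc no_loops' by (auto simp: P_def Q_def)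
  then have "distinct [b, c]" "{b, c} \<inter> (P \<union> Q) = {}" "P \<inter> Q = {}"
    using PB QC disj b c by auto
  then have "double_star G b c P Q"
    unfolding double_star_def using fin verts arcs by (intro conjI)
  moreover have "a \<in> P" "d \<in> Q"
    using ab cd sym \<open>a \<noteq> c\<close> \<open>d \<noteq> b\<close> by (auto simp: P_def Q_def)
  ultimately show thesis using that by blast
qed



text \<open>Leaves have a single neighbour, but each of three consecutive nodes of a cycle of length at
  least 3 has two, and there are only two centres. For the diameter, any two nodes are joined through
  their nearest centres, and leaves of different centres are not joined by a shorter walk.\<close>

lemma double_star_imp_tree_diameter_3:
  assumes G: "double_star G b c P Q" and ne: "P \<noteq> {}" "Q \<noteq> {}"
  shows "undirected_tree G" "graph_diameter G = ereal 3"
proof -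
  have arcs: "parcs G = {(b, c)} \<union> {b} \<times> P \<union> {c} \<times> Q \<union> ({(b, c)} \<union> {b} \<times> P \<union> {c} \<times> Q)\<inverse>"
    using G unfolding double_star_def Let_def by blast
  have arc_iff: "(x, y) \<in> parcs G \<longleftrightarrow> x = b \<and> (y = c \<or> y \<in> P) \<or> x = c \<and> (y = b \<or> y \<in> Q)
      \<or> y = b \<and> x \<in> P \<or> y = c \<and> x \<in> Q" for x y
    unfolding arcs by blast
  have verts: "pverts G = {b, c} \<union> P \<union> Q" "finite P" "finite Q"
    and disj: "b \<noteq> c" "b \<notin> P" "b \<notin> Q" "c \<notin> P" "c \<notin> Q" "P \<inter> Q = {}"
    using G by (auto simp: double_star_def)
  interpret pair_graph G
  proof
    show "finite (parcs G)"
      unfolding arcs using verts by simp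
    show "symmetric G"
      unfolding symmetric_def with_proj_simps arcs by (rule sym_Un_converse)
  next
    fix e assume e: "e \<in> parcs G"
    obtain x y where xy: "e = (x, y)" by (cases e)
    have arc: "(x, y) \<in> parcs G" using e xy by simp
    show "fst e \<in> pverts G" unfolding xy verts using arc unfolding arc_iff by auto
    show "snd e \<in> pverts G" unfolding xy verts using arc unfolding arc_iff by auto
    show "fst e \<noteq> snd e" unfolding xy using arc disj unfolding arc_iff by auto
  qed (simp add: verts)
  have near: "\<exists>v\<in>{b, c}. (x, v) \<in> (parcs G)\<^sup>=" if "x \<in> pverts G" for x
    using that unfolding verts by (auto simp: arc_iff)
  have centres: "(v, w) \<in> (parcs G)\<^sup>=" if "v \<in> {b, c}" "w \<in> {b, c}" for v w
    using that by (auto simp: arc_iff)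
  have le1: "\<exists>k\<le>1. (x, y) \<in> parcs G ^^ k" if "(x, y) \<in> (parcs G)\<^sup>=" for x y
    using that by (elim UnE) (force intro: exI[of _ 1] exI[of _ 0])+
  have le3: "\<exists>k\<le>3. (x, y) \<in> parcs G ^^ k" if xy: "x \<in> pverts G" "y \<in> pverts G" for x y
  proof -
    obtain v w where "(x, v) \<in> (parcs G)\<^sup>=" "(v, w) \<in> (parcs G)\<^sup>=" "(w, y) \<in> (parcs G)\<^sup>="
      using near[OF xy(1)] near[OF xy(2)] centres arcs_symmetric by blast
    then obtain i j k where "i \<le> 1" "j \<le> 1" "k \<le> 1"
      "(x, v) \<in> parcs G ^^ i" "(v, w) \<in> parcs G ^^ j" "(w, y) \<in> parcs G ^^ k"
      by (meson le1)
    then show ?thesis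
      by (intro exI[of _ "i + j + k"]) (auto simp: relpow_add)
  qed
  obtain a d where ad: "a \<in> P" "d \<in> Q" using ne by blast
  have "(a, d) \<notin> parcs G ^^ k" if "k \<le> 2" for k
  proof -
    from that consider "k = 0" | "k = 1" | "k = Suc (Suc 0)" by linarith
    then show ?thesis
      using ad disj by cases (auto simp: arc_iff)
  qed
  then have A: "\<exists>u\<in>pverts G. \<exists>v\<in>pverts G. \<forall>k\<le>2. (u, v) \<notin> parcs G ^^ k"
    using ad verts(1) by blast
  show "graph_diameter G = ereal 3"
    using graph_diameter_eq_Suc_iff[of G 2] le3 pair_wf_digraph A by auto
  have "connected (with_proj G)"
  proof (rule connectedI)
    fix x y assume "x \<in> pverts G" "y \<in> pverts G"
    then have "x \<rightarrow>\<^sup>*\<^bsub>G\<^esub> y"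
      using le3 by (subst reachable_conv') (auto dest: relpow_imp_rtrancl)
    then show "x \<rightarrow>\<^sup>*\<^bsub>with_proj (mk_symmetric G)\<^esub> y"
      using pair_sym_arcs by (simp add: reachable_mk_symmetric_eq)
  qed (use verts in auto)
  moreover have "\<not> (cycle p \<and> length p \<ge> 3)" for p
  proof
    assume "cycle p \<and> length p \<ge> 3"
    then obtain u e1 e2 e3 es where p: "p = e1 # e2 # e3 # es" and walk: "awalk u p u"
      and dist: "distinct (tl (awalk_verts u p))"
      by (auto simp: cycle_def Suc_le_length_iff numeral_3_eq_3)
    have branch: "v \<in> {b, c}" if "(v, w) \<in> parcs G" "(v, w') \<in> parcs G" "w \<noteq> w'" for v w w'
      using that disj by (auto simp: arc_iff)
    obtain x y z where e: "e1 = (u, x)" "e2 = (x, y)" "e3 = (y, z)"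
      and arcs: "(u, x) \<in> parcs G" "(x, y) \<in> parcs G" "(y, z) \<in> parcs G" and walk': "awalk z es u"
      using walk unfolding p by (cases e1; cases e2; cases e3) (auto simp: awalk_Cons_iff)
    have "distinct (x # y # awalk_verts z es)"
      using dist unfolding p e by simp
    moreover have "z \<in> set (awalk_verts z es)" "u \<in> set (awalk_verts z es)"
      using awends_of_awalk[OF walk'] hd_in_set[OF awalk_verts_non_Nil, of z es]
        last_in_set[OF awalk_verts_non_Nil, of z es] by simp_all
    \<comment> \<open>\<open>w\<close> is the predecessor of \<open>u\<close> on the cycle; for a triangle it is \<open>y\<close>.\<close>
    moreover obtain w where "(w, u) \<in> parcs G" "w \<in> set (y # awalk_verts z es)"
    proof (cases es rule: rev_cases)
      case Nil
      then show ?thesis using that arcs walk' by (auto simp: awalk_Nil_iff)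
    next
      case (snoc es' e)
      then have "e \<in> parcs G" "snd e = u"
        using walk' by (auto simp: awalk_Cons_iff awalk_Nil_iff)
      moreover have "fst e \<in> set (awalk_verts z es)"
        unfolding awalk_verts_conv snoc by simp
      ultimately show ?thesis using that[of "fst e"] by auto
    qed
    ultimately have "u \<noteq> x" "u \<noteq> y" "x \<noteq> y" "z \<noteq> x" "w \<noteq> x" "(w, u) \<in> parcs G" by auto
    then have "u \<in> {b, c}" "x \<in> {b, c}" "y \<in> {b, c}"
      using branch[of u x w] branch[of x u y] branch[of y x z] arcs arcs_symmetric by blast+
    with \<open>u \<noteq> x\<close> \<open>u \<noteq> y\<close> \<open>x \<noteq> y\<close> show False by auto
  qed
  ultimately show "undirected_tree G"
    unfolding undirected_tree_def using pair_graph by blast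
qed



section \<open>The Laplacian spectrum of a double star\<close>

text \<open>This is the Schur complement formula with the denominators cleared. Multiplication from the
  right by the block matrix with rows \<open>d I, 0\<close> and \<open>- C, I\<close> makes the matrix block upper
  triangular.\<close>

lemma det_four_block_scalar_lower_right:
  fixes A :: "'a :: idom mat"
  assumes A: "A \<in> carrier_mat m m" and B: "B \<in> carrier_mat m n"
    and C: "C \<in> carrier_mat n m"
  shows "det (four_block_mat A B C (d \<cdot>\<^sub>m 1\<^sub>m n)) * d ^ m = det (d \<cdot>\<^sub>m A - B * C) * d ^ n"
proof -
  let ?M = "four_block_mat A B C (d \<cdot>\<^sub>m 1\<^sub>m n)"
  let ?E = "four_block_mat (d \<cdot>\<^sub>m 1\<^sub>m m) (0\<^sub>m m n) (- C) (1\<^sub>m n)"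
  have "?M * ?E = four_block_mat (d \<cdot>\<^sub>m A - B * C) B (0\<^sub>m n m) (d \<cdot>\<^sub>m 1\<^sub>m n)"
    using A B C
    by (subst mult_four_block_mat[of _ m m _ n _ n])
       (auto intro!: cong_four_block_mat eq_matI simp: mult_smult_distrib)
  moreover have "det (?M * ?E) = det ?M * det ?E"
    using A B C by (intro det_mult[of _ "m + n"]) auto
  moreover have "det ?E = d ^ m"
    using C by (subst det_four_block_mat_upper_right_zero[of _ m _ n]) auto
  moreover have "det (four_block_mat (d \<cdot>\<^sub>m A - B * C) B (0\<^sub>m n m) (d \<cdot>\<^sub>m 1\<^sub>m n))
      = det (d \<cdot>\<^sub>m A - B * C) * d ^ n"
    using A B C by (subst det_four_block_mat_lower_left_zero[of _ m _ n]) auto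
  ultimately show ?thesis by simp
qed

text \<open>The norm drops the first entry of the sorted spectrum; if the other eigenvalues are positive,
  this is the eigenvalue 0, and the order of the others does not affect the sum.\<close>

lemma H2_norm_eq_sum_mset:
  assumes roots: "proots (char_poly (laplacian_mat G)) = add_mset 0 M"
    and pos: "\<And>x. x \<in># M \<Longrightarrow> x > 0"
    and size: "card (pverts G) = Suc (size M)"
  shows "H2_norm G = sqrt (\<Sum>x\<in>#M. 1 / (2 * x))"
proof -
  define xs where "xs = sorted_list_of_multiset M"
  have xs: "mset xs = M" by (simp add: xs_def)
  have "sorted (0 # xs)"
    using pos by (auto simp: xs_def less_imp_le)
  then have spec: "laplacian_spectrum G = 0 # xs"
    unfolding laplacian_spectrum_def roots xs[symmetric]
    by (metis mset.simps(2) properties_for_sort sorted_list_of_multiset_mset)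
  have "(\<Sum>i = 2..card (pverts G). 1 / (2 * laplacian_spectrum G ! (i - 1)))
      = (\<Sum>i<length xs. 1 / (2 * xs ! i))"
    using xs by (intro sum.reindex_bij_witness[of _ "\<lambda>i. i + 2" "\<lambda>i. i - 2"])
      (auto simp: spec size simp flip: xs simp: nth_Cons' numeral_2_eq_2)
  also have "\<dots> = (\<Sum>x\<in>#M. 1 / (2 * x))"
    unfolding xs[symmetric] by (simp add: sum_mset_sum_list sum_list_sum_nth atLeast0LessThan flip: mset_map)
  finally show ?thesis unfolding H2_norm_def by simp
qed

lemma pverts_double_palm [simp]: "pverts (double_palm N p q) = {..<N}"
  by (simp add: double_palm_def Let_def)

lemma parcs_double_palm:
  assumes "N = p + q + 2"
  shows "parcs (double_palm N p q) = (let E = {(0, 1)} \<union> {0} \<times> {2..<p + 2} \<union> {1} \<times> {p + 2..<N}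
    in E \<union> E\<inverse>)"
  using double_star_double_palm[OF assms] by (simp only: double_star_def)

lemma laplacian_mat_double_palm:
  assumes N: "N = p + q + 2"
  shows "laplacian_mat (double_palm N p q) = mat N N (\<lambda>(i, j).
     if i = j then (if i = 0 then real p + 1 else if i = 1 then real q + 1 else 1)
     else if (i, j) \<in> parcs (double_palm N p q) then - 1 else 0)"
proof -
  let ?G = "double_palm N p q"
  have le: "p + 2 \<le> N" using N by simp
  have out: "out_arcs (with_proj ?G) i = {i} \<times> (if i = 0 then {1..<p + 2}
      else if i = 1 then insert 0 {p + 2..<N} else if i < p + 2 then {0} else {1})"
    if "i < N" for i
    using that le by (auto simp: out_arcs_def parcs_double_palm[OF N] Let_def split: if_splits)
  have deg: "real (out_degree (with_proj ?G) i)
      = (if i = 0 then real p + 1 else if i = 1 then real q + 1 else 1)" if "i < N" for i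
    using that N unfolding out_degree_def out[OF that]
    by (auto simp: card_cartesian_product_singleton)
  have verts: "sorted_list_of_set (pverts ?G) = [0..<N]"
    by (simp add: lessThan_atLeast0)
  show ?thesis
    unfolding laplacian_mat_def degree_mat_def adjacency_mat_def verts Let_def
    by (rule eq_matI) (auto simp: mat_diag_def deg parcs_double_palm[OF N] Let_def simp del: upt_Suc)
qed

lemma det_2x2:
  assumes "A \<in> carrier_mat 2 2"
  shows "det A = A $$ (0, 0) * A $$ (1, 1) - A $$ (0, 1) * A $$ (1, 0)"
proof -
  have "det A = (\<Sum>j<2. A $$ (0, j) * cofactor A 0 j)"
    using assms by (intro laplace_expansion_row) auto
  also have "\<dots> = A $$ (0, 0) * A $$ (1, 1) - A $$ (0, 1) * A $$ (1, 0)"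
    using assms by (simp add: numeral_2_eq_2 cofactor_def mat_delete_def det_single)
  finally show ?thesis .
qed

text \<open>The nodes 0 and 1 are the centres and all others are leaves, so the leaf block of the
  characteristic matrix is \<open>a I\<close>. Eliminating it leaves a matrix of size 2. Its off-diagonal entries
  come from the edge between the centres alone, as no leaf is adjacent to both. The factor \<open>a ^ 2\<close>
  on the left is kept to avoid the exponent \<open>p + q - 2\<close>.\<close>

lemma char_poly_double_palm:
  fixes p q :: nat
  assumes N: "N = p + q + 2"
  defines "a \<equiv> [:- 1, 1:] :: real poly"
  shows "char_poly (laplacian_mat (double_palm N p q)) * a ^ 2
    = a ^ (p + q) * ([:1, - (real p + 2), 1:] * [:1, - (real q + 2), 1:] - a ^ 2)"
proof -
  define A :: "real poly mat" where "A = mat 2 2 (\<lambda>(i, j).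
    if i \<noteq> j then 1 else if i = 0 then [:- (real p + 1), 1:] else [:- (real q + 1), 1:])"
  define B :: "real poly mat" where "B = mat 2 (p + q) (\<lambda>(i, j). of_bool ((i = 0) = (j < p)))"
  define C where "C = transpose_mat B"
  have dims: "A \<in> carrier_mat 2 2" "B \<in> carrier_mat 2 (p + q)" "C \<in> carrier_mat (p + q) 2"
    by (simp_all add: A_def B_def C_def)
  have "char_poly_matrix (laplacian_mat (double_palm N p q))
      = four_block_mat A B C (a \<cdot>\<^sub>m 1\<^sub>m (p + q))"
    (is "?L = ?R")
  proof (rule eq_matI)
    fix i j assume "i < dim_row ?R" "j < dim_col ?R"
    then have ij': "i < p + q + 2" "j < p + q + 2" by (simp_all add: A_def a_def)
    then have ij: "i < N" "j < N" by (simp_all add: N)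
    have "?L $$ (i, j) = (if i = j then [:0, 1:] else 0)
      + [:- (laplacian_mat (double_palm N p q) $$ (i, j)):]"
      using ij unfolding char_poly_matrix_def laplacian_mat_double_palm[OF N] by simp
    also have "\<dots> = ?R $$ (i, j)"
      using ij ij' unfolding laplacian_mat_double_palm[OF N]
      by (cases "i < 2"; cases "j < 2")
        (auto simp: A_def B_def C_def a_def parcs_double_palm[OF N] Let_def one_pCons less_2_cases_iff)
    finally show "?L $$ (i, j) = ?R $$ (i, j)" .
  qed (simp_all add: char_poly_matrix_def laplacian_mat_double_palm[OF N] A_def a_def, simp_all add: N)
  then have "char_poly (laplacian_mat (double_palm N p q)) * a ^ 2
      = det (a \<cdot>\<^sub>m A - B * C) * a ^ (p + q)"
    unfolding char_poly_def using det_four_block_scalar_lower_right[OF dims, of a] by simp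
  also have "B * C = mat 2 2 (\<lambda>(i, j). if i \<noteq> j then 0 else if i = 0 then of_nat p else of_nat q)"
  proof (rule eq_matI, goal_cases)
    case (1 i j)
    then have "(B * C) $$ (i, j)
        = (\<Sum>k = 0..<p + q. of_bool ((i = 0) = (k < p) \<and> (j = 0) = (k < p)))"
      by (simp add: B_def C_def scalar_prod_def of_bool_conj)
    also have "\<dots> = of_nat (card {k \<in> {0..<p + q}. (i = 0) = (k < p) \<and> (j = 0) = (k < p)})"
      by (simp add: of_bool_def sum.If_cases Int_def)
    also have "{k \<in> {0..<p + q}. (i = 0) = (k < p) \<and> (j = 0) = (k < p)}
        = (if i \<noteq> j then {} else if i = 0 then {..<p} else {p..<p + q})"
      using 1 by (auto simp: less_2_cases_iff)
    finally show ?case using 1 by auto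
  qed (simp_all add: B_def C_def)
  also have "a \<cdot>\<^sub>m A - \<dots> = mat 2 2 (\<lambda>(i, j). if i \<noteq> j then a else
      if i = 0 then [:1, - (real p + 2), 1:] else [:1, - (real q + 2), 1:])"
    by (rule eq_matI) (auto simp: A_def a_def of_nat_poly)
  also have "det \<dots> = [:1, - (real p + 2), 1:] * [:1, - (real q + 2), 1:] - a ^ 2"
    by (subst det_2x2) (auto simp: power2_eq_square)
  finally show ?thesis by (simp add: mult.commute)
qed

text \<open>The cubic is negative at 0, positive at 1, negative at \<open>q + 2\<close> and positive at
  \<open>N + 2 = p + q + 4\<close>.\<close>

lemma cubic_three_positive_roots:
  fixes p q :: nat
  assumes "p \<ge> 1" "q \<ge> 1"
  defines "f \<equiv> [:- real (p + q + 2), real (p * q + 2 * (p + q + 2) + 1), - real (p + q + 4), 1:]"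
  obtains x y z where "0 < x" "x < y" "y < z" "f = [:- x, 1:] * [:- y, 1:] * [:- z, 1:]"
proof -
  have f0: "poly f 0 < 0" by (simp add: f_def)
  have f1: "poly f 1 > 0" using assms by (simp add: f_def)
  \<comment> \<open>\<open>x f(x) = (x^2 - (p + 2) x + 1) (x^2 - (q + 2) x + 1) - (x - 1)^2\<close>, and the second factor is 1
     at \<open>q + 2\<close>.\<close>
  have f2: "poly f (real q + 2) < 0"
  proof -
    have "poly f (real q + 2) = - real p"
      by (simp add: f_def algebra_simps)
    then show ?thesis using assms by simp
  qed
  have f3: "poly f (real (p + q + 4)) > 0"
  proof -
    have "poly f (real (p + q + 4))
        = real ((p + q + 4) * (p * q + 2 * (p + q + 2) + 1)) - real (p + q + 2)"
      by (simp add: f_def algebra_simps)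
    moreover have "p + q + 2 < (p + q + 4) * (p * q + 2 * (p + q + 2) + 1)"
      by (simp add: algebra_simps)
    ultimately show ?thesis by linarith
  qed
  obtain x where x: "0 < x" "x < 1" "poly f x = 0"
    using poly_IVT_pos[OF _ f0 f1] by auto
  obtain y where y: "1 < y" "y < real q + 2" "poly f y = 0"
    using poly_IVT_neg[OF _ f1 f2] by auto
  obtain z where z: "real q + 2 < z" "poly f z = 0"
    using poly_IVT_pos[OF _ f2 f3] by auto
  have "f = [:- x, 1:] * [:- y, 1:] * [:- z, 1:]"
  proof (rule poly_eqI_degree_lead_coeff[where A = "{x, y, z}" and n = 3])
    fix t assume "t \<in> {x, y, z}"
    then have "poly f t = 0" "poly ([:- x, 1:] * [:- y, 1:] * [:- z, 1:]) t = 0"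
      unfolding poly_mult using x y z by auto
    then show "poly f t = poly ([:- x, 1:] * [:- y, 1:] * [:- z, 1:]) t" by simp
  qed (use x y z in \<open>auto simp: f_def numeral_3_eq_3\<close>)
  moreover have "x < y" "y < z" using x y z by linarith+
  ultimately show ?thesis using that x(1) by blast
qed

section \<open>The norm of a double star and the ordering\<close>

lemma H2_norm_double_palm:
  assumes "p \<ge> 1" "q \<ge> 1" and N: "N = p + q + 2"
  shows "H2_norm (double_palm N p q)
    = sqrt ((real N - 4 + (real (p * q) + 2 * real N + 1) / real N) / 2)"
proof -
  let ?f = "[:- real (p + q + 2), real (p * q + 2 * (p + q + 2) + 1), - real (p + q + 4), 1:]"
  let ?a = "[:- 1, 1:] :: real poly"
  obtain x y z where xyz: "0 < x" "x < y" "y < z" and f: "?f = [:- x, 1:] * [:- y, 1:] * [:- z, 1:]"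
    using cubic_three_positive_roots[OF assms(1,2)] by metis
  have "char_poly (laplacian_mat (double_palm N p q)) * ?a ^ 2
      = (?a ^ (p + q - 2) * ([:0, 1:] * ?f)) * ?a ^ 2"
  proof -
    have "p + q = p + q - 2 + 2" using assms by simp
    then have "?a ^ (p + q) = ?a ^ (p + q - 2) * ?a ^ 2" by (metis power_add)
    moreover have "[:1, - (real p + 2), 1:] * [:1, - (real q + 2), 1:] - ?a ^ 2 = [:0, 1:] * ?f"
      by (simp add: power2_eq_square algebra_simps)
    ultimately show ?thesis
      unfolding char_poly_double_palm[OF N] by (simp only: mult_ac)
  qed
  then have cp: "char_poly (laplacian_mat (double_palm N p q))
      = [:0, 1:] * (?a ^ (p + q - 2) * ([:- x, 1:] * [:- y, 1:] * [:- z, 1:]))"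
    unfolding f by (subst (asm) mult_right_cancel) (simp_all add: mult.left_commute)
  have "proots (char_poly (laplacian_mat (double_palm N p q)))
      = add_mset 0 (replicate_mset (p + q - 2) 1 + {#x, y, z#})"
    unfolding cp
    by (simp only: proots_mult proots_power proots_linear_factor mult_eq_0_iff power_eq_0_iff
          pCons_eq_0_iff one_neq_zero simp_thms not_False_eq_True) simp
  then have "H2_norm (double_palm N p q)
      = sqrt (\<Sum>t\<in>#replicate_mset (p + q - 2) 1 + {#x, y, z#}. 1 / (2 * t))"
    by (rule H2_norm_eq_sum_mset) (use xyz assms in \<open>auto split: if_splits\<close>)
  also have "(\<Sum>t\<in>#replicate_mset (p + q - 2) 1 + {#x, y, z#}. 1 / (2 * t))
      = (real N - 4 + (1 / x + 1 / y + 1 / z)) / 2"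
    using assms by (simp add: field_simps)
  also have "1 / x + 1 / y + 1 / z = (real (p * q) + 2 * real N + 1) / real N"
  proof -
    \<comment> \<open>Vieta: comparison of the coefficients in the factorization of the cubic.\<close>
    have "real N = x * y * z" "real (p * q) + 2 * real N + 1 = x * y + y * z + x * z"
      using f N by (simp_all add: algebra_simps)
    then show ?thesis using xyz by (simp add: field_simps)
  qed
  finally show ?thesis .
qed
theorem theorem1:
  fixes N :: nat
  assumes "N \<ge> 4"
  shows "(\<forall>G \<in> (trees N 3 :: 'a pair_pre_digraph set). \<exists>p \<in> {1..(N - 2) div 2}.
            digraph_iso (with_proj G) (with_proj (double_palm N p (N - 2 - p))))
       \<and> (\<forall>p \<in> {1..(N - 2) div 2}. double_palm N p (N - 2 - p) \<in> trees N 3)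
       \<and> (\<forall>p \<in> {1..<(N - 2) div 2}.
            H2_norm (double_palm N p (N - 2 - p))
              < H2_norm (double_palm N (p + 1) (N - 2 - (p + 1))))"
proof (intro conjI ballI)
  fix G :: "'a pair_pre_digraph" assume "G \<in> trees N 3"
  then have tree: "undirected_tree G" "graph_diameter G = ereal 3" and N: "card (pverts G) = N"
    by (simp_all add: trees_def)
  obtain b c P Q where "double_star G b c P Q" "P \<noteq> {}" "Q \<noteq> {}"
    using tree_diameter_3_imp_double_star[OF tree] .
  \<comment> \<open>Name the centres so that the first one has at most as many leaves as the second one.\<close>
  then obtain b c P Q where G: "double_star G b c P Q" and ne: "P \<noteq> {}" and le: "card P \<le> card Q"
    using double_star_swap nat_le_linear by metis
  have "finite P" using G by (simp add: double_star_def)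
  then have P: "card P \<ge> 1" using ne by (simp add: Suc_le_eq card_gt_0_iff)
  have Q: "card Q = N - 2 - card P" and N2: "N = card P + (N - 2 - card P) + 2"
    using card_double_star[OF G] N by simp_all
  have "digraph_iso (with_proj G) (with_proj (double_palm N (card P) (N - 2 - card P)))"
    by (rule double_star_iso[OF G double_star_double_palm[OF N2]]) (use Q N2 in simp_all)
  moreover have "card P \<in> {1..(N - 2) div 2}"
    using P le Q by simp
  ultimately show "\<exists>p\<in>{1..(N - 2) div 2}.
      digraph_iso (with_proj G) (with_proj (double_palm N p (N - 2 - p)))" by blast
next
  fix p assume "p \<in> {1..(N - 2) div 2}"
  then have "p \<ge> 1" "N - 2 - p \<ge> 1" and N: "N = p + (N - 2 - p) + 2"
    using assms by auto
  then have "{2..<p + 2} \<noteq> {}" "{p + 2..<N} \<noteq> {}" by auto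
  then show "double_palm N p (N - 2 - p) \<in> trees N 3"
    using double_star_imp_tree_diameter_3[OF double_star_double_palm[OF N]] by (simp add: trees_def)
next
  fix p assume p: "p \<in> {1..<(N - 2) div 2}"
  define q where "q = N - 2 - (p + 1)"
  have q: "N - 2 - p = q + 1" "N = p + (q + 1) + 2" "N = (p + 1) + q + 2" "p < q" "p \<ge> 1"
    using p by (auto simp: q_def)
  \<comment> \<open>The difference of the two products is \<open>q - p\<close>.\<close>
  have "p * (q + 1) < (p + 1) * q" using q by simp
  then have "real (p * (q + 1)) < real ((p + 1) * q)" by (rule of_nat_less_iff[THEN iffD2])
  then have less: "(real (p * (q + 1)) + 2 * real N + 1) / real N
      < (real ((p + 1) * q) + 2 * real N + 1) / real N"
    using assms by (intro divide_strict_right_mono) linarith+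
  have "H2_norm (double_palm N p (q + 1))
      = sqrt ((real N - 4 + (real (p * (q + 1)) + 2 * real N + 1) / real N) / 2)"
    using q by (intro H2_norm_double_palm) simp_all
  moreover have "H2_norm (double_palm N (p + 1) q)
      = sqrt ((real N - 4 + (real ((p + 1) * q) + 2 * real N + 1) / real N) / 2)"
    using q by (intro H2_norm_double_palm) simp_all
  ultimately have "H2_norm (double_palm N p (q + 1)) < H2_norm (double_palm N (p + 1) q)"
    by (simp only: real_sqrt_less_iff) (intro divide_strict_right_mono add_strict_left_mono less; simp)
  then show "H2_norm (double_palm N p (N - 2 - p))
      < H2_norm (double_palm N (p + 1) (N - 2 - (p + 1)))"
    by (simp only: q(1) q_def)
qed

end
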